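(* For any cardinal $\kappa$, the class of (isomorphism classes of) persistence modules isomorphic to $\bigoplus_{\alpha\in A}I_\alpha$, where each $I_\alpha$ is an interval module and the cardinality of $A$ is at most $\kappa$, is a set.
   Context: Fix a field $\mathbf{k}$. A persistence module is a functor $M:(\mathbb{R},\le)\to \mathrm{Vect}_{\mathbf{k}}$; persistence modules are considered up to isomorphism. For an interval $J\subset\mathbb{R}$, the interval module $J$ is $\mathbf{k}$ at points of $J$ and $0$ elsewhere, with identity maps between points of $J$ and zero maps otherwise. "Is a set" is as opposed to being a proper class. *)

theory Defs
  imports "HOL-Analysis.Analysis" "HOL-Algebra.Module"
begin

definition linear_maps ::
  "('k, 'm) ring_scheme \<Rightarrow> ('k, 'v) module \<Rightarrow> ('k, 'w) module \<Rightarrow> ('v \<Rightarrow> 'w) set" where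
  "linear_maps K V W =
     {f \<in> carrier V \<rightarrow> carrier W.
        (\<forall>x\<in>carrier V. \<forall>y\<in>carrier V. f (x \<oplus>\<^bsub>V\<^esub> y) = f x \<oplus>\<^bsub>W\<^esub> f y) \<and>
        (\<forall>c\<in>carrier K. \<forall>x\<in>carrier V. f (c \<odot>\<^bsub>V\<^esub> x) = c \<odot>\<^bsub>W\<^esub> f x)}"

text \<open>
  The spaces at different times may have unrelated carriers and operations; they only share an
  ambient type. The multiplicative fields of the module records are irrelevant.
\<close>

record ('k, 'v) pmod =
  space_at :: "real \<Rightarrow> ('k, 'v) module"
  trans_map :: "real \<Rightarrow> real \<Rightarrow> 'v \<Rightarrow> 'v"

locale persistence_module = field K for K :: "('k, 'm) ring_scheme" (structure) +
  fixes M :: "('k, 'v) pmod"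
  assumes space: "Module.module K (space_at M t)"
    and trans_linear:
      "s \<le> t \<Longrightarrow> trans_map M s t \<in> linear_maps K (space_at M s) (space_at M t)"
    and trans_id: "x \<in> carrier (space_at M t) \<Longrightarrow> trans_map M t t x = x"
    and trans_comp:
      "\<lbrakk>s \<le> t; t \<le> u; x \<in> carrier (space_at M s)\<rbrakk>
        \<Longrightarrow> trans_map M t u (trans_map M s t x) = trans_map M s u x"

text \<open>
  Natural isomorphism. The two modules may live over different types, so that
  modules from different types can be compared.
\<close>

definition pmod_iso :: "('k, 'm) ring_scheme \<Rightarrow> ('k, 'v) pmod \<Rightarrow> ('k, 'w) pmod \<Rightarrow> bool" where
  "pmod_iso K M N \<longleftrightarrow>
     (\<exists>\<eta>. (\<forall>t. \<eta> t \<in> linear_maps K (space_at M t) (space_at N t) \<and>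
               bij_betw (\<eta> t) (carrier (space_at M t)) (carrier (space_at N t))) \<and>
          (\<forall>s t. s \<le> t \<longrightarrow> (\<forall>x\<in>carrier (space_at M s).
               \<eta> t (trans_map M s t x) = trans_map N s t (\<eta> s x))))"

definition interval_module :: "('k, 'm) ring_scheme \<Rightarrow> real set \<Rightarrow> ('k, 'k) pmod" where
  "interval_module K J =
     \<lparr> space_at = (\<lambda>t.
         \<lparr> carrier = (if t \<in> J then carrier K else {\<zero>\<^bsub>K\<^esub>}),
           mult = mult K, one = \<one>\<^bsub>K\<^esub>, zero = \<zero>\<^bsub>K\<^esub>, add = add K, smult = mult K \<rparr>),
       trans_map = (\<lambda>s t x. if s \<in> J \<and> t \<in> J then x else \<zero>\<^bsub>K\<^esub>) \<rparr>"

text \<open>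
  Pointwise direct sum: finitely supported families, normalised to \<^const>\<open>undefined\<close> outside
  the index set.
\<close>

definition direct_sum :: "'a set \<Rightarrow> ('a \<Rightarrow> ('k, 'w) pmod) \<Rightarrow> ('k, 'a \<Rightarrow> 'w) pmod" where
  "direct_sum A N =
     \<lparr> space_at = (\<lambda>t.
         \<lparr> carrier = {f \<in> \<Pi>\<^sub>E \<alpha>\<in>A. carrier (space_at (N \<alpha>) t).
                        finite {\<alpha> \<in> A. f \<alpha> \<noteq> \<zero>\<^bsub>space_at (N \<alpha>) t\<^esub>}},
           mult = (\<lambda>f g. \<lambda>\<alpha>\<in>A. f \<alpha> \<otimes>\<^bsub>space_at (N \<alpha>) t\<^esub> g \<alpha>),
           one = (\<lambda>\<alpha>\<in>A. \<one>\<^bsub>space_at (N \<alpha>) t\<^esub>),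
           zero = (\<lambda>\<alpha>\<in>A. \<zero>\<^bsub>space_at (N \<alpha>) t\<^esub>),
           add = (\<lambda>f g. \<lambda>\<alpha>\<in>A. f \<alpha> \<oplus>\<^bsub>space_at (N \<alpha>) t\<^esub> g \<alpha>),
           smult = (\<lambda>c f. \<lambda>\<alpha>\<in>A. c \<odot>\<^bsub>space_at (N \<alpha>) t\<^esub> f \<alpha>) \<rparr>),
       trans_map = (\<lambda>s t f. \<lambda>\<alpha>\<in>A. trans_map (N \<alpha>) s t (f \<alpha>)) \<rparr>"

text \<open>
  \<open>interval_sums K \<kappa> TYPE('a) :: ('k, 'v) pmod set\<close> is the part, visible in the type \<open>'v\<close> with
  index sets taken from \<open>'a\<close>, of the class of all modules that are isomorphic to a direct sum of at
  most \<open>\<kappa>\<close> interval modules. The class itself is the whole family, with \<open>'v\<close> and \<open>'a\<close> ranging over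
  all types. \<open>\<kappa>\<close> is a cardinal in the sense of \<^const>\<open>Card_order\<close>.
\<close>

definition interval_sums ::
  "('k, 'm) ring_scheme \<Rightarrow> 'c rel \<Rightarrow> 'a itself \<Rightarrow> ('k, 'v) pmod set" where
  "interval_sums K \<kappa> _ =
     {M. persistence_module K M \<and>
         (\<exists>(A :: 'a set) J. (card_of A, \<kappa>) \<in> ordLeq \<and>
            (\<forall>\<alpha>\<in>A. is_interval (J \<alpha>) \<and> J \<alpha> \<noteq> {}) \<and>
            pmod_iso K M (direct_sum A (\<lambda>\<alpha>. interval_module K (J \<alpha>))))}"

definition iso_classes :: "('k, 'm) ring_scheme \<Rightarrow> ('k, 'v) pmod set \<Rightarrow> ('k, 'v) pmod set set" where
  "iso_classes K X = X // {(M, N). M \<in> X \<and> N \<in> X \<and> pmod_iso K M N}"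

end

theory Submission
  imports Defs
begin

text \<open>
  Index sets and carriers may be taken from arbitrary types, but neither freedom produces new
  isomorphism classes. A direct sum depends, up to isomorphism, only on the family of its
  summands, so an index set \<open>A\<close> of cardinality at most \<open>\<kappa>\<close> can be
  replaced by its image under an injection into the underlying type of \<open>\<kappa>\<close>
  (\<open>pmod_iso_direct_sum_reindex\<close>). After this replacement the direct sum of interval
  modules is a persistence module whose carriers lie in one type, built from those of
  \<open>\<kappa>\<close> and of the field alone
  (\<open>persistence_module_interval_module\<close>,
  \<open>persistence_module_direct_sum\<close>). Hence every module in the class is isomorphic to
  a representative over this type.

  The isomorphism classes of these representatives form a set, and, since isomorphism is an
  equivalence relation (\<open>pmod_iso_refl\<close>, \<open>pmod_iso_sym\<close>, \<open>pmod_iso_trans\<close>), exactly one of them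
  consists of modules isomorphic to a given member of the class.
\<close>

section \<open>Isomorphism as an equivalence relation\<close>

lemma pmod_iso_refl: "pmod_iso K M M"
  unfolding pmod_iso_def linear_maps_def
  by (rule exI[of _ "\<lambda>t x. x"]) (auto simp: bij_betw_def)

lemma linear_maps_comp:
  assumes "f \<in> linear_maps K U V" "g \<in> linear_maps K V W"
  shows "g \<circ> f \<in> linear_maps K U W"
  using assms unfolding linear_maps_def by (auto simp: Pi_iff)

lemma pmod_iso_trans:
  assumes "pmod_iso K L M" "pmod_iso K M N"
  shows "pmod_iso K L N"
proof -
  obtain \<eta> where lin: "\<And>t. \<eta> t \<in> linear_maps K (space_at L t) (space_at M t)"
    and bij: "\<And>t. bij_betw (\<eta> t) (carrier (space_at L t)) (carrier (space_at M t))"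
    and nat: "\<And>s t x. s \<le> t \<Longrightarrow> x \<in> carrier (space_at L s) \<Longrightarrow>
               \<eta> t (trans_map L s t x) = trans_map M s t (\<eta> s x)"
    using assms(1) unfolding pmod_iso_def by blast
  obtain \<theta> where lin': "\<And>t. \<theta> t \<in> linear_maps K (space_at M t) (space_at N t)"
    and bij': "\<And>t. bij_betw (\<theta> t) (carrier (space_at M t)) (carrier (space_at N t))"
    and nat': "\<And>s t x. s \<le> t \<Longrightarrow> x \<in> carrier (space_at M s) \<Longrightarrow>
               \<theta> t (trans_map M s t x) = trans_map N s t (\<theta> s x)"
    using assms(2) unfolding pmod_iso_def by blast
  show ?thesis
    unfolding pmod_iso_def
  proof (intro exI[of _ "\<lambda>t. \<theta> t \<circ> \<eta> t"] conjI allI impI ballI)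
    fix t
    show "\<theta> t \<circ> \<eta> t \<in> linear_maps K (space_at L t) (space_at N t)"
      using lin lin' by (rule linear_maps_comp)
    show "bij_betw (\<theta> t \<circ> \<eta> t) (carrier (space_at L t)) (carrier (space_at N t))"
      using bij bij' by (rule bij_betw_trans)
  next
    fix s t :: real and x
    assume "s \<le> t" "x \<in> carrier (space_at L s)"
    moreover from this have "\<eta> s x \<in> carrier (space_at M s)"
      using bij bij_betwE by metis
    ultimately show "(\<theta> t \<circ> \<eta> t) (trans_map L s t x) = trans_map N s t ((\<theta> s \<circ> \<eta> s) x)"
      by (simp add: nat nat')
  qed
qed

text \<open>
  That the inverse of a bijective linear map is linear uses closure of the source under the
  operations, which is why the source is required to be a module.
\<close>

lemma linear_maps_inv_into:
  assumes V: "Module.module K V" and f: "f \<in> linear_maps K V W"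
    and bij: "bij_betw f (carrier V) (carrier W)"
  shows "inv_into (carrier V) f \<in> linear_maps K W V"
proof -
  interpret V: Module.module K V by (rule V)
  let ?g = "inv_into (carrier V) f"
  have g_in: "?g y \<in> carrier V" if "y \<in> carrier W" for y
    using that bij by (simp add: bij_betw_imp_surj_on inv_into_into)
  have fg: "f (?g y) = y" if "y \<in> carrier W" for y
    using that bij by (simp add: bij_betw_inv_into_right)
  have gf: "?g (f x) = x" if "x \<in> carrier V" for x
    using that bij by (simp add: bij_betw_inv_into_left)
  have "?g (x \<oplus>\<^bsub>W\<^esub> y) = ?g x \<oplus>\<^bsub>V\<^esub> ?g y" if "x \<in> carrier W" "y \<in> carrier W" for x y
  proof -
    have "f (?g x \<oplus>\<^bsub>V\<^esub> ?g y) = x \<oplus>\<^bsub>W\<^esub> y"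
      using f that by (simp add: linear_maps_def g_in fg)
    then show ?thesis
      using gf[of "?g x \<oplus>\<^bsub>V\<^esub> ?g y"] that by (simp add: g_in)
  qed
  moreover have "?g (c \<odot>\<^bsub>W\<^esub> x) = c \<odot>\<^bsub>V\<^esub> ?g x" if "c \<in> carrier K" "x \<in> carrier W" for c x
  proof -
    have "f (c \<odot>\<^bsub>V\<^esub> ?g x) = c \<odot>\<^bsub>W\<^esub> x"
      using f that by (simp add: linear_maps_def g_in fg)
    then show ?thesis
      using gf[of "c \<odot>\<^bsub>V\<^esub> ?g x"] that by (simp add: g_in)
  qed
  ultimately show ?thesis
    by (simp add: linear_maps_def g_in)
qed

lemma pmod_iso_sym:
  assumes M: "persistence_module K M" and iso: "pmod_iso K M N"
  shows "pmod_iso K N M"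
proof -
  interpret persistence_module K M by (rule M)
  obtain \<eta> where lin: "\<And>t. \<eta> t \<in> linear_maps K (space_at M t) (space_at N t)"
    and bij: "\<And>t. bij_betw (\<eta> t) (carrier (space_at M t)) (carrier (space_at N t))"
    and nat: "\<And>s t x. s \<le> t \<Longrightarrow> x \<in> carrier (space_at M s) \<Longrightarrow>
               \<eta> t (trans_map M s t x) = trans_map N s t (\<eta> s x)"
    using iso unfolding pmod_iso_def by blast
  define \<theta> where "\<theta> t = inv_into (carrier (space_at M t)) (\<eta> t)" for t
  show ?thesis
    unfolding pmod_iso_def
  proof (intro exI[of _ \<theta>] conjI allI impI ballI)
    fix t
    show "\<theta> t \<in> linear_maps K (space_at N t) (space_at M t)"
      unfolding \<theta>_def using space lin bij by (rule linear_maps_inv_into)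
    show "bij_betw (\<theta> t) (carrier (space_at N t)) (carrier (space_at M t))"
      unfolding \<theta>_def using bij by (rule bij_betw_inv_into)
  next
    fix s t :: real and y
    assume st: "s \<le> t" and y: "y \<in> carrier (space_at N s)"
    define x where "x = \<theta> s y"
    have x: "x \<in> carrier (space_at M s)" and yx: "y = \<eta> s x"
      using bij[of s] y unfolding x_def \<theta>_def
      by (simp_all add: bij_betw_imp_surj_on inv_into_into bij_betw_inv_into_right)
    have "trans_map M s t x \<in> carrier (space_at M t)"
      using trans_linear[OF st] x by (auto simp: linear_maps_def)
    then have "\<theta> t (\<eta> t (trans_map M s t x)) = trans_map M s t x"
      unfolding \<theta>_def by (rule bij_betw_inv_into_left[OF bij])
    then show "\<theta> t (trans_map N s t y) = trans_map M s t (\<theta> s y)"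
      unfolding x_def[symmetric] using nat[OF st x, folded yx] by simp
  qed
qed

lemma equiv_pmod_iso:
  assumes "\<And>M. M \<in> X \<Longrightarrow> persistence_module K M"
  shows "equiv X {(M, N). M \<in> X \<and> N \<in> X \<and> pmod_iso K M N}"
proof (rule equivI)
  show "refl_on X {(M, N). M \<in> X \<and> N \<in> X \<and> pmod_iso K M N}"
    by (auto simp: refl_on_def intro: pmod_iso_refl)
  show "sym {(M, N). M \<in> X \<and> N \<in> X \<and> pmod_iso K M N}"
    using assms by (auto simp: sym_def intro: pmod_iso_sym)
  show "trans {(M, N). M \<in> X \<and> N \<in> X \<and> pmod_iso K M N}"
    by (auto simp: trans_def intro: pmod_iso_trans)
qed auto

section \<open>Direct sums of interval modules\<close>

text \<open>
  Convexity of \<open>J\<close> enters through functoriality: for \<open>s \<le> t \<le> u\<close> with \<open>s\<close> and \<open>u\<close> in \<open>J\<close>, the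
  composite \<open>s \<rightarrow> t \<rightarrow> u\<close> is the identity only if \<open>t\<close> lies in \<open>J\<close>.
\<close>

lemma persistence_module_interval_module:
  assumes "field K" and J: "is_interval J"
  shows "persistence_module K (interval_module K J)"
proof -
  interpret field K by (rule assms(1))
  have between: "t \<in> J" if "s \<in> J" "u \<in> J" "s \<le> t" "t \<le> u" for s t u
    using J that unfolding is_interval_1 by blast
  show ?thesis
  proof (intro persistence_module.intro persistence_module_axioms.intro)
    show "field K" by (rule assms(1))
  next
    show "Module.module K (space_at (interval_module K J) t)" for t
    proof (rule moduleI)
      show "cring K" ..
      show "abelian_group (space_at (interval_module K J) t)"
      proof (rule abelian_groupI, goal_cases)
        case (6 x)
        then show ?case
          by (intro bexI[of _ "\<ominus>\<^bsub>K\<^esub> x"])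
            (auto simp: interval_module_def l_neg split: if_splits)
      qed (auto simp: interval_module_def a_ac split: if_splits)
    qed (auto simp: interval_module_def l_distr r_distr m_assoc split: if_splits)
    show "trans_map (interval_module K J) s t
        \<in> linear_maps K (space_at (interval_module K J) s) (space_at (interval_module K J) t)"
      if "s \<le> t" for s t
      by (auto simp: interval_module_def linear_maps_def)
    show "trans_map (interval_module K J) t t x = x"
      if "x \<in> carrier (space_at (interval_module K J) t)" for t x
      using that by (auto simp: interval_module_def split: if_splits)
    show "trans_map (interval_module K J) t u (trans_map (interval_module K J) s t x)
        = trans_map (interval_module K J) s u x"
      if "s \<le> t" "t \<le> u" "x \<in> carrier (space_at (interval_module K J) s)" for s t u x
      using that by (auto simp: interval_module_def dest: between split: if_splits)
  qed
qed

lemma linear_maps_zero: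
  assumes "Module.module K V" "Module.module K W" "f \<in> linear_maps K V W"
  shows "f \<zero>\<^bsub>V\<^esub> = \<zero>\<^bsub>W\<^esub>"
proof -
  interpret V: Module.module K V by (rule assms)
  interpret W: Module.module K W by (rule assms)
  have in_W: "f \<zero>\<^bsub>V\<^esub> \<in> carrier W"
    using assms(3) by (auto simp: linear_maps_def)
  have "f (\<zero>\<^bsub>V\<^esub> \<oplus>\<^bsub>V\<^esub> \<zero>\<^bsub>V\<^esub>) = f \<zero>\<^bsub>V\<^esub> \<oplus>\<^bsub>W\<^esub> f \<zero>\<^bsub>V\<^esub>"
    using assms(3) V.zero_closed unfolding linear_maps_def by blast
  then show ?thesis
    using in_W by (simp add: W.add.r_cancel_one')
qed

text \<open>
  The operations act componentwise, so each law of a persistence module is inherited from the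
  summands; beyond that, only the finiteness of the support needs an argument. It is preserved
  because every operation involved sends zero to zero.
\<close>

lemma persistence_module_direct_sum:
  assumes "field K" and N: "\<And>\<alpha>. \<alpha> \<in> A \<Longrightarrow> persistence_module K (N \<alpha>)"
  shows "persistence_module K (direct_sum A N)"
proof -
  interpret field K by (rule assms(1))
  let ?V = "\<lambda>t. space_at (direct_sum A N) t"
  let ?W = "\<lambda>\<alpha> t. space_at (N \<alpha>) t"
  let ?supp = "\<lambda>t f. {\<alpha> \<in> A. f \<alpha> \<noteq> \<zero>\<^bsub>?W \<alpha> t\<^esub>}"
  have mod: "Module.module K (?W \<alpha> t)" if "\<alpha> \<in> A" for \<alpha> t
    using N[OF that] by (rule persistence_module.space)
  have ag: "abelian_group (?W \<alpha> t)" if "\<alpha> \<in> A" for \<alpha> t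
    using mod[OF that] by (rule Module.module.axioms)
  note agD = abelian_group.axioms(1)[OF ag]
  have lin: "trans_map (N \<alpha>) s t \<in> linear_maps K (?W \<alpha> s) (?W \<alpha> t)"
    if "\<alpha> \<in> A" "s \<le> t" for \<alpha> s t
    using N[OF that(1)] that(2) by (rule persistence_module.trans_linear)
  have carrier: "f \<in> carrier (?V t) \<longleftrightarrow>
      f \<in> extensional A \<and> (\<forall>\<alpha>\<in>A. f \<alpha> \<in> carrier (?W \<alpha> t)) \<and> finite (?supp t f)" for f t
    by (auto simp: direct_sum_def PiE_def Pi_iff)
  have ext: "f = g" if "f \<in> carrier (?V t)" "g \<in> carrier (?V t)"
    "\<And>\<alpha>. \<alpha> \<in> A \<Longrightarrow> f \<alpha> = g \<alpha>" for f g t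
    using that by (auto simp: carrier intro: extensionalityI)
  have zero: "\<zero>\<^bsub>?V t\<^esub> = (\<lambda>\<alpha>\<in>A. \<zero>\<^bsub>?W \<alpha> t\<^esub>)"
    and add: "f \<oplus>\<^bsub>?V t\<^esub> g = (\<lambda>\<alpha>\<in>A. f \<alpha> \<oplus>\<^bsub>?W \<alpha> t\<^esub> g \<alpha>)"
    and smult: "c \<odot>\<^bsub>?V t\<^esub> f = (\<lambda>\<alpha>\<in>A. c \<odot>\<^bsub>?W \<alpha> t\<^esub> f \<alpha>)"
    and tm: "trans_map (direct_sum A N) s t f = (\<lambda>\<alpha>\<in>A. trans_map (N \<alpha>) s t (f \<alpha>))" for s t c f g
    by (simp_all add: direct_sum_def)
  have W_zero: "\<zero>\<^bsub>?W \<alpha> t\<^esub> \<in> carrier (?W \<alpha> t)" if "\<alpha> \<in> A" for \<alpha> t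
    using abelian_monoid.zero_closed[OF agD[OF that]] .
  have W_l_zero: "\<zero>\<^bsub>?W \<alpha> t\<^esub> \<oplus>\<^bsub>?W \<alpha> t\<^esub> x = x" if "\<alpha> \<in> A" "x \<in> carrier (?W \<alpha> t)" for \<alpha> t x
    using abelian_monoid.l_zero[OF agD[OF that(1)] that(2)] .
  have W_add: "x \<oplus>\<^bsub>?W \<alpha> t\<^esub> y \<in> carrier (?W \<alpha> t)"
    if "\<alpha> \<in> A" "x \<in> carrier (?W \<alpha> t)" "y \<in> carrier (?W \<alpha> t)" for \<alpha> t x y
    using abelian_monoid.a_closed[OF agD[OF that(1)] that(2,3)] .
  have W_smult: "c \<odot>\<^bsub>?W \<alpha> t\<^esub> x \<in> carrier (?W \<alpha> t)"
    if "\<alpha> \<in> A" "c \<in> carrier K" "x \<in> carrier (?W \<alpha> t)" for \<alpha> t c x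
    using Module.module.smult_closed[OF mod[OF that(1)] that(2,3)] .
  have W_smult_zero: "c \<odot>\<^bsub>?W \<alpha> t\<^esub> \<zero>\<^bsub>?W \<alpha> t\<^esub> = \<zero>\<^bsub>?W \<alpha> t\<^esub>"
    if "\<alpha> \<in> A" "c \<in> carrier K" for \<alpha> t c
    using Module.module.smult_r_null[OF mod[OF that(1)] that(2)] .
  have map_closed: "(\<lambda>\<alpha>\<in>A. h \<alpha> (f \<alpha>)) \<in> carrier (?V t)"
    if f: "f \<in> carrier (?V s)"
      and cl: "\<And>\<alpha> x. \<alpha> \<in> A \<Longrightarrow> x \<in> carrier (?W \<alpha> s) \<Longrightarrow> h \<alpha> x \<in> carrier (?W \<alpha> t)"
      and z: "\<And>\<alpha>. \<alpha> \<in> A \<Longrightarrow> h \<alpha> \<zero>\<^bsub>?W \<alpha> s\<^esub> = \<zero>\<^bsub>?W \<alpha> t\<^esub>" for s t f h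
  proof -
    have "?supp t (\<lambda>\<alpha>\<in>A. h \<alpha> (f \<alpha>)) \<subseteq> ?supp s f"
      using z by auto
    then have "finite (?supp t (\<lambda>\<alpha>\<in>A. h \<alpha> (f \<alpha>)))"
      by (rule finite_subset) (use f in \<open>simp add: carrier\<close>)
    then show ?thesis
      using f cl unfolding carrier by auto
  qed
  have zero_closed: "\<zero>\<^bsub>?V t\<^esub> \<in> carrier (?V t)" for t
  proof -
    have "?supp t (\<zero>\<^bsub>?V t\<^esub>) = {}"
      by (auto simp: zero)
    then show ?thesis
      unfolding carrier by (auto simp: zero W_zero)
  qed
  have add_closed: "f \<oplus>\<^bsub>?V t\<^esub> g \<in> carrier (?V t)"
    if f: "f \<in> carrier (?V t)" and g: "g \<in> carrier (?V t)" for f g t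
  proof -
    have "?supp t (f \<oplus>\<^bsub>?V t\<^esub> g) \<subseteq> ?supp t f \<union> ?supp t g"
      by (auto simp: add W_l_zero W_zero)
    then have "finite (?supp t (f \<oplus>\<^bsub>?V t\<^esub> g))"
      by (rule finite_subset) (use f g in \<open>simp add: carrier\<close>)
    then show ?thesis
      using f g unfolding carrier by (auto simp: add W_add)
  qed
  have smult_closed: "c \<odot>\<^bsub>?V t\<^esub> f \<in> carrier (?V t)"
    if "c \<in> carrier K" "f \<in> carrier (?V t)" for c f t
    unfolding smult using that by (intro map_closed) (auto simp: W_smult W_smult_zero)
  have tm_closed: "trans_map (direct_sum A N) s t f \<in> carrier (?V t)"
    if "s \<le> t" "f \<in> carrier (?V s)" for s t f
    unfolding tm
  proof (rule map_closed[OF that(2)])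
    fix \<alpha> assume \<alpha>: "\<alpha> \<in> A"
    show "trans_map (N \<alpha>) s t x \<in> carrier (?W \<alpha> t)" if "x \<in> carrier (?W \<alpha> s)" for x
      using lin[OF \<alpha> \<open>s \<le> t\<close>] that by (auto simp: linear_maps_def)
    show "trans_map (N \<alpha>) s t \<zero>\<^bsub>?W \<alpha> s\<^esub> = \<zero>\<^bsub>?W \<alpha> t\<^esub>"
      using mod mod lin[OF \<alpha> \<open>s \<le> t\<close>] \<alpha> by (intro linear_maps_zero)
  qed
  have component: "f \<alpha> \<in> carrier (?W \<alpha> t)" if "f \<in> carrier (?V t)" "\<alpha> \<in> A" for f t \<alpha>
    using that by (simp add: carrier)
  show ?thesis
  proof (intro persistence_module.intro persistence_module_axioms.intro)
    show "field K" by (rule assms(1))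
  next
    fix t
    show "Module.module K (?V t)"
    proof (rule moduleI)
      show "cring K" ..
      show "abelian_group (?V t)"
      proof (rule abelian_groupI)
        fix f g h assume fgh: "f \<in> carrier (?V t)" "g \<in> carrier (?V t)" "h \<in> carrier (?V t)"
        show "f \<oplus>\<^bsub>?V t\<^esub> g \<oplus>\<^bsub>?V t\<^esub> h = f \<oplus>\<^bsub>?V t\<^esub> (g \<oplus>\<^bsub>?V t\<^esub> h)"
          using fgh by (intro ext[of _ t])
            (simp_all only: add_closed, simp add: add component abelian_monoid.a_assoc[OF agD])
      next
        fix f g assume fg: "f \<in> carrier (?V t)" "g \<in> carrier (?V t)"
        show "f \<oplus>\<^bsub>?V t\<^esub> g = g \<oplus>\<^bsub>?V t\<^esub> f"
          using fg by (auto simp: add component abelian_monoid.a_comm[OF agD] intro!: restrict_ext)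
      next
        fix f assume f: "f \<in> carrier (?V t)"
        show "\<zero>\<^bsub>?V t\<^esub> \<oplus>\<^bsub>?V t\<^esub> f = f"
          using f by (intro ext[of _ t]) (simp_all only: add_closed zero_closed,
              simp add: add zero component W_l_zero)
        \<comment> \<open>The negative is the multiple by \<open>\<ominus> \<one>\<close>, whose support is already known to be finite.\<close>
        show "\<exists>g\<in>carrier (?V t). g \<oplus>\<^bsub>?V t\<^esub> f = \<zero>\<^bsub>?V t\<^esub>"
        proof
          show neg: "(\<ominus>\<^bsub>K\<^esub> \<one>\<^bsub>K\<^esub>) \<odot>\<^bsub>?V t\<^esub> f \<in> carrier (?V t)"
            using f by (intro smult_closed) auto
          show "((\<ominus>\<^bsub>K\<^esub> \<one>\<^bsub>K\<^esub>) \<odot>\<^bsub>?V t\<^esub> f) \<oplus>\<^bsub>?V t\<^esub> f = \<zero>\<^bsub>?V t\<^esub>"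
          proof (rule ext[OF add_closed[OF neg f] zero_closed])
            fix \<alpha> assume \<alpha>: "\<alpha> \<in> A"
            interpret W: Module.module K "?W \<alpha> t" by (rule mod[OF \<alpha>])
            have "f \<alpha> \<in> carrier (?W \<alpha> t)" using f \<alpha> by (rule component)
            then have "((\<ominus>\<^bsub>K\<^esub> \<one>\<^bsub>K\<^esub>) \<odot>\<^bsub>?W \<alpha> t\<^esub> f \<alpha>) \<oplus>\<^bsub>?W \<alpha> t\<^esub> f \<alpha> = \<zero>\<^bsub>?W \<alpha> t\<^esub>"
              by (simp add: W.smult_l_minus W.l_neg)
            then show "(((\<ominus>\<^bsub>K\<^esub> \<one>\<^bsub>K\<^esub>) \<odot>\<^bsub>?V t\<^esub> f) \<oplus>\<^bsub>?V t\<^esub> f) \<alpha> = \<zero>\<^bsub>?V t\<^esub> \<alpha>"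
              using \<alpha> by (simp add: add smult zero)
          qed
        qed
      qed (auto intro: add_closed zero_closed)
    next
      fix a b f assume "a \<in> carrier K" "b \<in> carrier K" "f \<in> carrier (?V t)"
      then show "(a \<oplus>\<^bsub>K\<^esub> b) \<odot>\<^bsub>?V t\<^esub> f = a \<odot>\<^bsub>?V t\<^esub> f \<oplus>\<^bsub>?V t\<^esub> b \<odot>\<^bsub>?V t\<^esub> f"
        and "(a \<otimes>\<^bsub>K\<^esub> b) \<odot>\<^bsub>?V t\<^esub> f = a \<odot>\<^bsub>?V t\<^esub> (b \<odot>\<^bsub>?V t\<^esub> f)"
        by (auto simp: add smult component Module.module.smult_l_distr[OF mod]
            Module.module.smult_assoc1[OF mod] intro!: restrict_ext)
    next
      fix a f g assume "a \<in> carrier K" "f \<in> carrier (?V t)" "g \<in> carrier (?V t)"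
      then show "a \<odot>\<^bsub>?V t\<^esub> (f \<oplus>\<^bsub>?V t\<^esub> g) = a \<odot>\<^bsub>?V t\<^esub> f \<oplus>\<^bsub>?V t\<^esub> a \<odot>\<^bsub>?V t\<^esub> g"
        by (auto simp: add smult component Module.module.smult_r_distr[OF mod]
            intro!: restrict_ext)
    next
      fix f assume f: "f \<in> carrier (?V t)"
      show "\<one>\<^bsub>K\<^esub> \<odot>\<^bsub>?V t\<^esub> f = f"
      proof (rule ext[OF smult_closed[OF one_closed f] f])
        fix \<alpha> assume "\<alpha> \<in> A"
        then show "(\<one>\<^bsub>K\<^esub> \<odot>\<^bsub>?V t\<^esub> f) \<alpha> = f \<alpha>"
          using f by (simp add: smult component Module.module.smult_one[OF mod])
      qed
    qed (rule smult_closed)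
  next
    fix s t :: real assume st: "s \<le> t"
    show "trans_map (direct_sum A N) s t \<in> linear_maps K (?V s) (?V t)"
      unfolding linear_maps_def
    proof (intro CollectI conjI ballI funcsetI)
      fix f g assume "f \<in> carrier (?V s)" "g \<in> carrier (?V s)"
      then show "trans_map (direct_sum A N) s t (f \<oplus>\<^bsub>?V s\<^esub> g) =
          trans_map (direct_sum A N) s t f \<oplus>\<^bsub>?V t\<^esub> trans_map (direct_sum A N) s t g"
        using lin[OF _ st] by (auto simp: tm add component linear_maps_def intro!: restrict_ext)
    next
      fix c f assume "c \<in> carrier K" "f \<in> carrier (?V s)"
      then show "trans_map (direct_sum A N) s t (c \<odot>\<^bsub>?V s\<^esub> f) =
          c \<odot>\<^bsub>?V t\<^esub> trans_map (direct_sum A N) s t f"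
        using lin[OF _ st] by (auto simp: tm smult component linear_maps_def intro!: restrict_ext)
    qed (rule tm_closed[OF st])
  next
    fix f t assume f: "f \<in> carrier (?V t)"
    show "trans_map (direct_sum A N) t t f = f"
    proof (rule ext[OF tm_closed[OF order_refl f] f])
      fix \<alpha> assume "\<alpha> \<in> A"
      then show "trans_map (direct_sum A N) t t f \<alpha> = f \<alpha>"
        using f by (simp add: tm component persistence_module.trans_id[OF N])
    qed
  next
    fix f and s t u :: real assume "s \<le> t" "t \<le> u" "f \<in> carrier (?V s)"
    then show "trans_map (direct_sum A N) t u (trans_map (direct_sum A N) s t f) =
        trans_map (direct_sum A N) s u f"
      by (auto simp: tm component persistence_module.trans_comp[OF N] intro!: restrict_ext)
  qed
qed

text \<open>
  Relabelling the index set along a bijection \<open>h\<close> identifies the two direct sums by precomposition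
  with \<open>h\<close>.
\<close>

lemma pmod_iso_direct_sum_reindex:
  fixes N :: "'a \<Rightarrow> ('k, 'v) pmod" and h :: "'b \<Rightarrow> 'a"
  assumes h: "bij_betw h B A"
  shows "pmod_iso K (direct_sum A N) (direct_sum B (\<lambda>\<beta>. N (h \<beta>)))"
proof -
  let ?S = "direct_sum A N" and ?T = "direct_sum B (\<lambda>\<beta>. N (h \<beta>))"
  define g where "g = inv_into B h"
  have hA: "h \<beta> \<in> A" if "\<beta> \<in> B" for \<beta>
    using h that by (auto dest: bij_betwE)
  have gB: "g \<alpha> \<in> B" if "\<alpha> \<in> A" for \<alpha>
    using bij_betw_inv_into[OF h] that by (auto simp: g_def dest: bij_betwE)
  have hg: "h (g \<alpha>) = \<alpha>" if "\<alpha> \<in> A" for \<alpha>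
    using h that by (simp add: g_def bij_betw_inv_into_right)
  have gh: "g (h \<beta>) = \<beta>" if "\<beta> \<in> B" for \<beta>
    using h that by (simp add: g_def bij_betw_inv_into_left)
  define \<eta> :: "('a \<Rightarrow> 'v) \<Rightarrow> 'b \<Rightarrow> 'v" where "\<eta> f = (\<lambda>\<beta>\<in>B. f (h \<beta>))" for f
  define \<theta> :: "('b \<Rightarrow> 'v) \<Rightarrow> 'a \<Rightarrow> 'v" where "\<theta> f = (\<lambda>\<alpha>\<in>A. f (g \<alpha>))" for f
  have to: "\<eta> f \<in> carrier (space_at ?T t)" if f: "f \<in> carrier (space_at ?S t)" for f t
  proof -
    have "{\<beta> \<in> B. \<eta> f \<beta> \<noteq> \<zero>\<^bsub>space_at (N (h \<beta>)) t\<^esub>}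
        \<subseteq> g ` {\<alpha> \<in> A. f \<alpha> \<noteq> \<zero>\<^bsub>space_at (N \<alpha>) t\<^esub>}"
    proof
      fix \<beta> assume "\<beta> \<in> {\<beta> \<in> B. \<eta> f \<beta> \<noteq> \<zero>\<^bsub>space_at (N (h \<beta>)) t\<^esub>}"
      then show "\<beta> \<in> g ` {\<alpha> \<in> A. f \<alpha> \<noteq> \<zero>\<^bsub>space_at (N \<alpha>) t\<^esub>}"
        by (intro rev_image_eqI[of "h \<beta>"]) (auto simp: \<eta>_def hA gh)
    qed
    then have "finite {\<beta> \<in> B. \<eta> f \<beta> \<noteq> \<zero>\<^bsub>space_at (N (h \<beta>)) t\<^esub>}"
      by (rule finite_subset) (use f in \<open>simp add: direct_sum_def\<close>)
    moreover have "\<eta> f \<in> (\<Pi>\<^sub>E \<beta>\<in>B. carrier (space_at (N (h \<beta>)) t))"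
      using f hA by (auto simp: \<eta>_def direct_sum_def)
    ultimately show ?thesis
      by (simp add: direct_sum_def)
  qed
  have fro: "\<theta> f \<in> carrier (space_at ?S t)" if f: "f \<in> carrier (space_at ?T t)" for f t
  proof -
    have "{\<alpha> \<in> A. \<theta> f \<alpha> \<noteq> \<zero>\<^bsub>space_at (N \<alpha>) t\<^esub>}
        \<subseteq> h ` {\<beta> \<in> B. f \<beta> \<noteq> \<zero>\<^bsub>space_at (N (h \<beta>)) t\<^esub>}"
    proof
      fix \<alpha> assume "\<alpha> \<in> {\<alpha> \<in> A. \<theta> f \<alpha> \<noteq> \<zero>\<^bsub>space_at (N \<alpha>) t\<^esub>}"
      then show "\<alpha> \<in> h ` {\<beta> \<in> B. f \<beta> \<noteq> \<zero>\<^bsub>space_at (N (h \<beta>)) t\<^esub>}"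
        by (intro rev_image_eqI[of "g \<alpha>"]) (auto simp: \<theta>_def gB hg)
    qed
    then have "finite {\<alpha> \<in> A. \<theta> f \<alpha> \<noteq> \<zero>\<^bsub>space_at (N \<alpha>) t\<^esub>}"
      by (rule finite_subset) (use f in \<open>simp add: direct_sum_def\<close>)
    moreover have "\<theta> f \<in> (\<Pi>\<^sub>E \<alpha>\<in>A. carrier (space_at (N \<alpha>) t))"
    proof -
      have "f (g \<alpha>) \<in> carrier (space_at (N (h (g \<alpha>))) t)" if "\<alpha> \<in> A" for \<alpha>
        using f gB[OF that] by (auto simp: direct_sum_def)
      then show ?thesis by (auto simp: \<theta>_def hg)
    qed
    ultimately show ?thesis
      by (simp add: direct_sum_def)
  qed
  have "\<theta> (\<eta> f) = f" if "f \<in> carrier (space_at ?S t)" for f t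
    using that by (intro extensionalityI[of _ A])
      (auto simp: \<theta>_def \<eta>_def gB hg direct_sum_def PiE_def)
  moreover have "\<eta> (\<theta> f) = f" if "f \<in> carrier (space_at ?T t)" for f t
    using that by (intro extensionalityI[of _ B])
      (auto simp: \<theta>_def \<eta>_def hA gh direct_sum_def PiE_def)
  ultimately have bij: "bij_betw \<eta> (carrier (space_at ?S t)) (carrier (space_at ?T t))" for t
    using to fro by (intro bij_betw_byWitness[where f' = \<theta>]) auto
  show ?thesis
    unfolding pmod_iso_def
  proof (intro exI[of _ "\<lambda>t. \<eta>"] conjI allI impI ballI)
    fix t
    show "\<eta> \<in> linear_maps K (space_at ?S t) (space_at ?T t)"
      using to by (auto simp: linear_maps_def) (auto simp: \<eta>_def direct_sum_def hA)
    show "bij_betw \<eta> (carrier (space_at ?S t)) (carrier (space_at ?T t))"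
      by (rule bij)
  next
    fix s t f
    show "\<eta> (trans_map ?S s t f) = trans_map ?T s t (\<eta> f)"
      by (auto simp: \<eta>_def direct_sum_def hA)
  qed
qed

section \<open>Representatives over a single type\<close>

text \<open>
  An injection of the index set into the underlying type of \<open>\<kappa>\<close> moves the whole direct sum there.
  The modules on both sides live over unrelated types, which is what makes the isomorphism classes
  over the single type \<open>'c \<Rightarrow> 'k\<close> exhaust the class.
\<close>

lemma interval_sums_representative:
  fixes K :: "('k, 'm) ring_scheme" and \<kappa> :: "'c rel" and M :: "('k, 'v) pmod"
  assumes K: "field K" and \<kappa>: "Card_order \<kappa>" and M: "M \<in> interval_sums K \<kappa> TYPE('a)"
  obtains N :: "('k, 'c \<Rightarrow> 'k) pmod"
  where "N \<in> interval_sums K \<kappa> TYPE('c)" "pmod_iso K M N"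
proof -
  obtain A :: "'a set" and J where A: "(card_of A, \<kappa>) \<in> ordLeq"
    and J: "\<And>\<alpha>. \<alpha> \<in> A \<Longrightarrow> is_interval (J \<alpha>) \<and> J \<alpha> \<noteq> {}"
    and M_iso: "pmod_iso K M (direct_sum A (\<lambda>\<alpha>. interval_module K (J \<alpha>)))"
    using M unfolding interval_sums_def by blast
  \<comment> \<open>A cardinal is isomorphic to the cardinality of its field, so the bound yields an injection.\<close>
  have "(card_of A, card_of (Field \<kappa>)) \<in> ordLeq"
    using A card_of_Field_ordIso[OF \<kappa>] ordIso_symmetric ordLeq_ordIso_trans by blast
  then obtain g :: "'a \<Rightarrow> 'c" where "inj_on g A"
    unfolding card_of_ordLeq[symmetric] by blast
  then have g: "bij_betw g A (g ` A)"
    by (rule inj_on_imp_bij_betw)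
  define B where "B = g ` A"
  define h where "h = inv_into A g"
  have h: "bij_betw h B A"
    unfolding h_def B_def using g by (rule bij_betw_inv_into)
  then have hA: "h \<beta> \<in> A" if "\<beta> \<in> B" for \<beta>
    using that by (auto dest: bij_betwE)
  have "(card_of B, card_of A) \<in> ordIso"
    using h card_of_ordIso by blast
  then have B: "(card_of B, \<kappa>) \<in> ordLeq"
    using A by (rule ordIso_ordLeq_trans)
  define N where "N = direct_sum B (\<lambda>\<beta>. interval_module K (J (h \<beta>)))"
  have "persistence_module K N"
    unfolding N_def using K J hA
    by (intro persistence_module_direct_sum persistence_module_interval_module) auto
  then have "N \<in> interval_sums K \<kappa> TYPE('c)"
    unfolding interval_sums_def using B J hA pmod_iso_refl[of K N]
    by (auto simp: N_def intro!: exI[of _ B] exI[of _ "\<lambda>\<beta>. J (h \<beta>)"])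
  moreover have "pmod_iso K M N"
    unfolding N_def using M_iso pmod_iso_direct_sum_reindex[OF h] by (rule pmod_iso_trans)
  ultimately show ?thesis
    by (rule that)
qed

theorem proposition3p29:
  fixes K :: "('k, 'm) ring_scheme" and \<kappa> :: "'c rel"
  assumes "field K" and "Card_order \<kappa>"
  shows "\<exists>S :: ('k, 'c \<Rightarrow> 'k) pmod set set.
           S = iso_classes K (interval_sums K \<kappa> TYPE('c)) \<and>
           (\<forall>M \<in> (interval_sums K \<kappa> TYPE('a) :: ('k, 'v) pmod set).
              \<exists>!C. C \<in> S \<and> (\<forall>N\<in>C. pmod_iso K M N))"
proof (rule exI, rule conjI[OF refl], rule ballI)
  fix M :: "('k, 'v) pmod"
  assume M: "M \<in> interval_sums K \<kappa> TYPE('a)"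
  define X where "X = (interval_sums K \<kappa> TYPE('c) :: ('k, 'c \<Rightarrow> 'k) pmod set)"
  define R where "R = {(M, N). M \<in> X \<and> N \<in> X \<and> pmod_iso K M N}"
  have R: "equiv X R"
    unfolding R_def by (rule equiv_pmod_iso) (simp add: X_def interval_sums_def)
  have pm: "persistence_module K M"
    using M by (simp add: interval_sums_def)
  obtain N where N: "N \<in> X" and MN: "pmod_iso K M N"
    using interval_sums_representative[OF assms M] unfolding X_def by blast
  have "\<exists>!C. C \<in> X // R \<and> (\<forall>N\<in>C. pmod_iso K M N)"
  proof (rule ex1I[of _ "R `` {N}"], intro conjI ballI)
    show "R `` {N} \<in> X // R"
      using N by (rule quotientI)
    show "pmod_iso K M L" if "L \<in> R `` {N}" for L
      using that MN by (auto simp: R_def intro: pmod_iso_trans)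
  next
    fix C assume C: "C \<in> X // R \<and> (\<forall>N\<in>C. pmod_iso K M N)"
    then obtain L where L: "L \<in> X" "C = R `` {L}"
      by (auto elim: quotientE)
    then have "L \<in> C"
      using equiv_class_self[OF R] by simp
    then have "pmod_iso K N L"
      using C MN pm pmod_iso_sym pmod_iso_trans by blast
    then show "C = R `` {N}"
      using L N equiv_class_eq[OF R, of N L] by (simp add: R_def)
  qed
  then show "\<exists>!C. C \<in> iso_classes K (interval_sums K \<kappa> TYPE('c) :: ('k, 'c \<Rightarrow> 'k) pmod set) \<and> (\<forall>N\<in>C. pmod_iso K M N)"
    by (simp add: iso_classes_def X_def R_def)
qed

end
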